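(* Let $\ell, r \geq 1$ be integers. If $M$ is a finite simple gammoid of rank $r$ with no minor isomorphic to $U_{2,\ell+2}$, then $$|E(M)| \leq \ell(r-1)+1.$$
   Context: All matroids and directed graphs are finite. $E(M)$ denotes the ground set of a matroid $M$. A matroid is simple if it has no loops and no parallel pairs. A minor of $M$ is a matroid obtained from $M$ by a sequence of deletions and contractions. For integers $0 \leq k \leq m$, the uniform matroid $U_{k,m}$ is the matroid on an $m$-element ground set whose independent sets are precisely the subsets of size at most $k$. Gammoids: let $D$ be a finite directed graph and let $T, E \subseteq V(D)$. A set $I \subseteq E$ is linkable to $T$ if there are pairwise vertex-disjoint directed paths in $D$ whose initial vertices are exactly the elements of $I$ and whose terminal vertices lie in $T$ (paths of length zero are allowed). The subsets of $E$ linkable to $T$ are the independent sets of a matroid on $E$; a matroid arising in this way is called a gammoid. *)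

theory Defs
  imports Graph_Theory.Graph_Theory
begin

section \<open>Finite matroids\<close>

record 'a set_system =
  ground :: "'a set"
  indeps :: "'a set set"

locale matroid =
  fixes M :: "'a set_system"
  assumes finite_ground: "finite (ground M)"
    and indep_subset_ground: "I \<in> indeps M \<Longrightarrow> I \<subseteq> ground M"
    and empty_indep: "{} \<in> indeps M"
    and indep_mono: "I \<in> indeps M \<Longrightarrow> J \<subseteq> I \<Longrightarrow> J \<in> indeps M"
    and augmentation: "I \<in> indeps M \<Longrightarrow> J \<in> indeps M \<Longrightarrow> card J < card I \<Longrightarrow>
      \<exists>x \<in> I - J. insert x J \<in> indeps M"

definition matroid_rank :: "'a set_system \<Rightarrow> nat" where
  "matroid_rank M = Max (card ` indeps M)"

definition is_loop :: "'a set_system \<Rightarrow> 'a \<Rightarrow> bool" where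
  "is_loop M e \<longleftrightarrow> e \<in> ground M \<and> {e} \<notin> indeps M"

definition parallel_pair :: "'a set_system \<Rightarrow> 'a \<Rightarrow> 'a \<Rightarrow> bool" where
  "parallel_pair M e f \<longleftrightarrow>
     e \<in> ground M \<and> f \<in> ground M \<and> e \<noteq> f \<and>
     \<not> is_loop M e \<and> \<not> is_loop M f \<and> {e, f} \<notin> indeps M"

definition simple_matroid :: "'a set_system \<Rightarrow> bool" where
  "simple_matroid M \<longleftrightarrow>
     matroid M \<and> (\<forall>e. \<not> is_loop M e) \<and> (\<forall>e f. \<not> parallel_pair M e f)"

definition matroid_isomorphic :: "'a set_system \<Rightarrow> 'b set_system \<Rightarrow> bool" where
  "matroid_isomorphic M N \<longleftrightarrow>
     (\<exists>f. bij_betw f (ground M) (ground N) \<and>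
          (\<forall>X \<subseteq> ground M. X \<in> indeps M \<longleftrightarrow> f ` X \<in> indeps N))"

definition uniform_matroid :: "nat \<Rightarrow> nat \<Rightarrow> nat set_system" where
  "uniform_matroid k m =
     \<lparr> ground = {..<m}, indeps = {I. I \<subseteq> {..<m} \<and> card I \<le> k} \<rparr>"

section \<open>Minors\<close>

definition delete :: "'a set_system \<Rightarrow> 'a set \<Rightarrow> 'a set_system" where
  "delete M X =
     \<lparr> ground = ground M - X, indeps = {I \<in> indeps M. I \<subseteq> ground M - X} \<rparr>"

definition basis_of :: "'a set_system \<Rightarrow> 'a set \<Rightarrow> 'a set \<Rightarrow> bool" where
  "basis_of M X B \<longleftrightarrow>
     B \<in> indeps M \<and> B \<subseteq> X \<and> (\<forall>C \<in> indeps M. B \<subseteq> C \<and> C \<subseteq> X \<longrightarrow> C = B)"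

text \<open>In a matroid the independent sets of the contraction do not depend on
  the basis of \<open>X\<close> that is chosen.\<close>

definition contract :: "'a set_system \<Rightarrow> 'a set \<Rightarrow> 'a set_system" where
  "contract M X =
     \<lparr> ground = ground M - X,
       indeps = {I. I \<subseteq> ground M - X \<and> (\<exists>B. basis_of M X B \<and> I \<union> B \<in> indeps M)} \<rparr>"

inductive minor :: "'a set_system \<Rightarrow> 'a set_system \<Rightarrow> bool" for M where
  minor_refl: "minor M M"
| minor_delete: "minor M N \<Longrightarrow> X \<subseteq> ground N \<Longrightarrow> minor M (delete N X)"
| minor_contract: "minor M N \<Longrightarrow> X \<subseteq> ground N \<Longrightarrow> minor M (contract N X)"

section \<open>Gammoids\<close>

text \<open>The path leaving \<open>v\<close> is given by its list of arcs \<open>p v\<close>; the empty list is the path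
  of length zero at \<open>v\<close>, whose vertex list is \<open>[v]\<close>.\<close>

definition linkable :: "('v, 'e) pre_digraph \<Rightarrow> 'v set \<Rightarrow> 'v set \<Rightarrow> bool" where
  "linkable D T I \<longleftrightarrow>
     (\<exists>p. (\<forall>v \<in> I. \<exists>t \<in> T. pre_digraph.apath D v (p v) t) \<and>
          (\<forall>u \<in> I. \<forall>v \<in> I. u \<noteq> v \<longrightarrow>
             set (pre_digraph.awalk_verts D u (p u)) \<inter>
             set (pre_digraph.awalk_verts D v (p v)) = {}))"

definition gammoid_of :: "('v, 'e) pre_digraph \<Rightarrow> 'v set \<Rightarrow> 'v set \<Rightarrow> 'v set_system" where
  "gammoid_of D T E = \<lparr> ground = E, indeps = {I. I \<subseteq> E \<and> linkable D T I} \<rparr>"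

text \<open>A predicate on \<open>M\<close> cannot quantify over the vertex and arc types of the representing
  digraph. Finite digraphs can always be relabelled by natural numbers, so they are taken
  over \<open>nat\<close> and \<open>M\<close> is compared up to isomorphism; \<open>gammoid_gammoid_of\<close> below shows that
  nothing is lost by this.\<close>

definition gammoid :: "'a set_system \<Rightarrow> bool" where
  "gammoid M \<longleftrightarrow> matroid M \<and>
     (\<exists>(D :: (nat, nat) pre_digraph) T E.
        fin_digraph D \<and> T \<subseteq> verts D \<and> E \<subseteq> verts D \<and>
        matroid_isomorphic M (gammoid_of D T E))"

lemma (in wf_digraph) linkable_app_iso:
  assumes hom: "digraph_isomorphism hom" and "I \<subseteq> verts G" "T \<subseteq> verts G" "linkable G T I"
  shows "linkable (app_iso hom G) (iso_verts hom ` T) (iso_verts hom ` I)"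
proof -
  let ?g = "iso_verts hom" and ?H = "app_iso hom G"
  interpret H: wf_digraph ?H using hom ..
  have inj: "inj_on ?g (verts G)" using hom by (rule digraph_isomorphism_inj_on_verts)
  obtain p where p: "\<And>v. v \<in> I \<Longrightarrow> \<exists>t \<in> T. apath v (p v) t"
    and disj: "\<And>u v. u \<in> I \<Longrightarrow> v \<in> I \<Longrightarrow> u \<noteq> v \<Longrightarrow>
        set (awalk_verts u (p u)) \<inter> set (awalk_verts v (p v)) = {}"
    using assms(4) unfolding linkable_def by blast
  define q where "q w = map (iso_arcs hom) (p (iso_verts (inv_iso hom) w))" for w
  have q: "q (?g v) = map (iso_arcs hom) (p v)" if "v \<in> I" for v
    using that assms(2) hom by (auto simp: q_def)
  have vs: "set (awalk_verts v (p v)) \<subseteq> verts G"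
    "H.awalk_verts (?g v) (q (?g v)) = map ?g (awalk_verts v (p v))" if "v \<in> I" for v
  proof -
    from p[OF that] obtain t where "awalk v (p v) t" by (auto simp: apath_def)
    then show "set (awalk_verts v (p v)) \<subseteq> verts G"
      "H.awalk_verts (?g v) (q (?g v)) = map ?g (awalk_verts v (p v))"
      using awalk_verts_app_iso_eq[OF hom] q[OF that] by (auto dest: awalk_verts_in_verts)
  qed
  have "\<exists>t \<in> ?g ` T. H.apath (?g v) (q (?g v)) t" if v: "v \<in> I" for v
  proof -
    from p[OF v] obtain t where t: "t \<in> T" "awalk v (p v) t" "distinct (awalk_verts v (p v))"
      by (auto simp: apath_def)
    have "H.awalk (?g v) (q (?g v)) (?g t)"
      using awalk_app_isoI[OF t(2) hom] q[OF v] by simp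
    moreover have "distinct (H.awalk_verts (?g v) (q (?g v)))"
      using t(3) vs[OF v] inj by (auto simp: distinct_map intro: inj_on_subset)
    ultimately show ?thesis using t(1) by (auto simp: H.apath_def)
  qed
  moreover have "set (H.awalk_verts (?g u) (q (?g u))) \<inter> set (H.awalk_verts (?g v) (q (?g v))) = {}"
    if "u \<in> I" "v \<in> I" "?g u \<noteq> ?g v" for u v
  proof -
    have "?g ` set (awalk_verts u (p u)) \<inter> ?g ` set (awalk_verts v (p v))
        = ?g ` (set (awalk_verts u (p u)) \<inter> set (awalk_verts v (p v)))"
      using inj_on_image_Int[OF inj] vs that by metis
    also have "\<dots> = {}" using disj that by (metis image_empty)
    finally show ?thesis using vs that by simp
  qed
  ultimately show ?thesis
    unfolding linkable_def by (intro exI[of _ q]) auto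
qed

lemma (in fin_digraph) gammoid_gammoid_of:
  assumes "T \<subseteq> verts G" "E \<subseteq> verts G" "matroid (gammoid_of G T E)"
  shows "gammoid (gammoid_of G T E)"
proof -
  obtain g :: "'a \<Rightarrow> nat" where g: "inj_on g (verts G)"
    using finite_imp_inj_to_nat_seg[OF finite_verts] by blast
  obtain h :: "'b \<Rightarrow> nat" where h: "inj_on h (arcs G)"
    using finite_imp_inj_to_nat_seg[OF finite_arcs] by blast
  define hom where "hom = \<lparr> iso_verts = g, iso_arcs = h,
    iso_head = (\<lambda>n. g (head G (the_inv_into (arcs G) h n))),
    iso_tail = (\<lambda>n. g (tail G (the_inv_into (arcs G) h n))) \<rparr>"
  have hom: "digraph_isomorphism hom"
    using g h wf_digraph unfolding digraph_isomorphism_def hom_def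
    by (auto simp: the_inv_into_f_f)
  let ?H = "app_iso hom G"
  interpret H: fin_digraph ?H using hom ..
  have ihom: "H.digraph_isomorphism (inv_iso hom)"
    using hom by (rule digraph_isomorphism_invI)
  have [simp]: "iso_verts hom = g" by (simp add: hom_def)
  have cancel: "iso_verts (inv_iso hom) ` g ` X = X" if "X \<subseteq> verts G" for X
    using that iso_verts_inv_iso[OF hom] by (force simp: image_image)
  have "linkable G T X \<longleftrightarrow> linkable ?H (g ` T) (g ` X)" if X: "X \<subseteq> verts G" for X
  proof
    assume "linkable G T X"
    then show "linkable ?H (g ` T) (g ` X)"
      using linkable_app_iso[OF hom X assms(1)] by simp
  next
    assume "linkable ?H (g ` T) (g ` X)"
    then have "linkable (app_iso (inv_iso hom) ?H)
        (iso_verts (inv_iso hom) ` g ` T) (iso_verts (inv_iso hom) ` g ` X)"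
      using X assms(1) by (intro H.linkable_app_iso[OF ihom]) auto
    then show "linkable G T X" using cancel X assms(1) app_iso_inv[OF hom] by simp
  qed
  then have "matroid_isomorphic (gammoid_of G T E) (gammoid_of ?H (g ` T) (g ` E))"
    unfolding matroid_isomorphic_def gammoid_of_def
    using assms(2) g by (intro exI[of _ g]) (auto simp: bij_betw_def intro: inj_on_subset)
  moreover have "g ` T \<subseteq> verts ?H" "g ` E \<subseteq> verts ?H" using assms(1,2) by auto
  ultimately show ?thesis
    unfolding gammoid_def using H.fin_digraph_axioms assms(3) by blast
qed

end

theory Submission
  imports Defs
begin

text \<open>A set \<open>I\<close> of vertices is linkable to \<open>T\<close> iff the sets \<open>{v} \<union> N\<^sup>+(v)\<close>, \<open>v \<notin> T\<close>, have a system
  of distinct representatives avoiding \<open>I\<close>: representatives are successors along the paths. By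
  Hall's theorem this means \<open>|I| \<le> slack L\<close> for all \<open>L \<supseteq> I\<close>, where \<open>slack L\<close> is \<open>|L|\<close> minus the
  number of sets of the family inside \<open>L\<close>. Families of sets, unlike digraphs, are trivially closed
  under contraction: contracting \<open>e\<close> removes \<open>e\<close> from every set.

  In a simple gammoid of rank \<open>r\<close> on \<open>E\<close> every line \<open>L\<close> lies in a maximal set of slack 2, which
  contains at least \<open>|L| - 2\<close> sets of the family, and different lines share few of these sets.
  This gives \<open>\<Sum>\<^sub>L (|L| - 2) \<le> |E| - r\<close>, summed over all lines. In a counterexample with \<open>r\<close> minimal,
  contraction of any \<open>e\<close> shows that at most \<open>l (r - 2) + 1\<close> lines pass through \<open>e\<close>, and lines have
  at most \<open>l + 1\<close> points. Summing \<open>|E| - 1 = \<Sum>\<^bsub>L \<ni> e\<^esub> (|L| - 1)\<close> over \<open>e\<close> contradicts the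
  inequality above.\<close>

section \<open>Slack of a family of sets\<close>

lemma card_Un_Diff:
  assumes "finite X" "finite Y"
  shows "card (X \<union> Y) = card (X - Y) + card Y"
  using assms card_Un_disjoint[of "X - Y" Y] by (simp add: Diff_disjoint inf_commute)

locale set_family =
  fixes V :: "'v set" and J :: "'j set" and A :: "'j \<Rightarrow> 'v set"
  assumes finite_V [simp]: "finite V" and finite_J [simp]: "finite J"
begin

definition inner :: "'v set \<Rightarrow> 'j set" where
  "inner L = {j \<in> J. A j \<subseteq> L}"

definition slack :: "'v set \<Rightarrow> int" where
  "slack L = int (card L) - int (card (inner L))"

text \<open>If all \<open>A j\<close> lie in \<open>V\<close>, Hall's theorem turns this into the
  existence of distinct representatives in \<open>V - I\<close>. If the family has a transversal at
  all, the free sets are the independent sets of the dual of its transversal matroid.\<close>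

definition free :: "'v set \<Rightarrow> bool" where
  "free I \<longleftrightarrow> I \<subseteq> V \<and> (\<forall>L. I \<subseteq> L \<longrightarrow> L \<subseteq> V \<longrightarrow> int (card I) \<le> slack L)"

text \<open>An analogue of matroid closure: if every superset of \<open>B\<close> in
  \<open>V\<close> has slack at least \<open>k\<close> and some superset attains \<open>k\<close>,
  this is the largest one attaining it.\<close>

definition slack_hull :: "int \<Rightarrow> 'v set \<Rightarrow> 'v set" where
  "slack_hull k B = \<Union>{X. B \<subseteq> X \<and> X \<subseteq> V \<and> slack X \<le> k}"

section \<open>Submodularity of the slack, free sets and hulls\<close>

lemma finite_sub [simp]: "X \<subseteq> V \<Longrightarrow> finite X"
  using finite_V finite_subset by blast

lemma finite_inner [simp]: "finite (inner L)"
  by (simp add: inner_def)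

lemma inner_mono: "X \<subseteq> Y \<Longrightarrow> inner X \<subseteq> inner Y"
  by (auto simp: inner_def)

lemma inner_Int: "inner (X \<inter> Y) = inner X \<inter> inner Y"
  by (auto simp: inner_def)

text \<open>Cardinality is modular, whereas the number of sets inside is supermodular: a set inside
  \<open>X\<close> or inside \<open>Y\<close> is inside the union, and one inside both is inside the
  intersection.\<close>

lemma slack_submodular:
  assumes "X \<subseteq> V" "Y \<subseteq> V"
  shows "slack (X \<inter> Y) + slack (X \<union> Y) \<le> slack X + slack Y"
proof -
  have "card X + card Y = card (X \<union> Y) + card (X \<inter> Y)"
    using assms by (intro card_Un_Int) simp_all
  moreover have "card (inner X) + card (inner Y)
      = card (inner X \<union> inner Y) + card (inner (X \<inter> Y))"
    unfolding inner_Int by (intro card_Un_Int) simp_all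
  moreover have "card (inner X \<union> inner Y) \<le> card (inner (X \<union> Y))"
    by (intro card_mono) (auto simp: inner_def)
  ultimately show ?thesis unfolding slack_def by linarith
qed

lemma slack_Un_le:
  assumes "L \<subseteq> V" "X \<subseteq> V"
  shows "slack (L \<union> X) \<le> slack L + int (card (X - L))"
proof -
  have "card (L \<union> X) = card L + card (X - L)"
    using assms card_Un_Diff[of X L] by (simp add: Un_commute)
  moreover have "card (inner L) \<le> card (inner (L \<union> X))"
    by (intro card_mono inner_mono) auto
  ultimately show ?thesis unfolding slack_def by linarith
qed

lemma freeD: "free I \<Longrightarrow> I \<subseteq> L \<Longrightarrow> L \<subseteq> V \<Longrightarrow> int (card I) \<le> slack L"
  by (simp add: free_def)

text \<open>The inequality for \<open>I\<close> is applied to \<open>L \<union> I\<close>. Passing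
  back to \<open>L\<close> costs at most \<open>card (I - L)\<close>, and the remaining
  \<open>I \<inter> L\<close> contains \<open>K\<close>.\<close>

lemma free_subset:
  assumes "free I" "K \<subseteq> I"
  shows "free K"
  unfolding free_def
proof (intro conjI allI impI)
  have IV: "I \<subseteq> V" using assms(1) by (simp add: free_def)
  then show "K \<subseteq> V" using assms(2) by blast
  fix L assume L: "K \<subseteq> L" "L \<subseteq> V"
  have "int (card I) \<le> slack L + int (card (I - L))"
    using freeD[OF assms(1), of "L \<union> I"] slack_Un_le[OF L(2) IV] L IV by simp
  moreover have "card I = card (I - L) + card (I \<inter> L)"
    using IV card_Un_Diff[of I "I \<inter> L"] by (simp add: Un_absorb2 Diff_Int)
  moreover have "card K \<le> card (I \<inter> L)"
    using assms(2) L IV by (intro card_mono) auto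
  ultimately show "int (card K) \<le> slack L" by linarith
qed

text \<open>Sets over \<open>B\<close> attaining the minimal slack \<open>k\<close> are closed under
  union: the intersection still contains \<open>B\<close>, so its slack is at least
  \<open>k\<close>, and submodularity bounds the union.\<close>

lemma slack_hull_props:
  assumes "B \<subseteq> X" "X \<subseteq> V" "slack X \<le> k"
    and min: "\<And>Y. B \<subseteq> Y \<Longrightarrow> Y \<subseteq> V \<Longrightarrow> k \<le> slack Y"
  shows "B \<subseteq> slack_hull k B \<and> slack_hull k B \<subseteq> V \<and> slack (slack_hull k B) \<le> k"
proof -
  let ?\<X> = "{X. B \<subseteq> X \<and> X \<subseteq> V \<and> slack X \<le> k}"
  have closed: "B \<subseteq> \<Union>\<Y> \<and> \<Union>\<Y> \<subseteq> V \<and> slack (\<Union>\<Y>) \<le> k"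
    if "finite \<Y>" "\<Y> \<noteq> {}" "\<Y> \<subseteq> ?\<X>" for \<Y>
    using that
  proof (induction \<Y> rule: finite_ne_induct)
    case (insert X \<Y>)
    have X: "B \<subseteq> X" "X \<subseteq> V" "slack X \<le> k"
      and U: "B \<subseteq> \<Union>\<Y>" "\<Union>\<Y> \<subseteq> V" "slack (\<Union>\<Y>) \<le> k"
      using insert by auto
    have "k \<le> slack (X \<inter> \<Union>\<Y>)" using X U by (intro min) auto
    then have "slack (X \<union> \<Union>\<Y>) \<le> k"
      using slack_submodular[of X "\<Union>\<Y>"] X U by linarith
    then show ?case using X U by auto
  qed auto
  have "finite ?\<X>" by (rule finite_subset[of _ "Pow V"]) auto
  moreover have "?\<X> \<noteq> {}" using assms(1-3) by auto
  ultimately have "B \<subseteq> \<Union>?\<X> \<and> \<Union>?\<X> \<subseteq> V \<and> slack (\<Union>?\<X>) \<le> k"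
    by (rule closed) simp
  then show ?thesis by (simp only: slack_hull_def)
qed

lemma slack_hull_upper: "B \<subseteq> X \<Longrightarrow> X \<subseteq> V \<Longrightarrow> slack X \<le> k \<Longrightarrow> X \<subseteq> slack_hull k B"
  by (auto simp: slack_hull_def)

text \<open>Outside the largest set \<open>Z\<close> of slack 0 (the loops), the maximal sets of slack at most 1 (the
  parallel classes) are disjoint, and each of them contains at most one point of \<open>E\<close>; so the
  count can be done class by class.\<close>

lemma card_inner_Union_le:
  assumes "E \<subseteq> V" and pairs: "\<And>x y. x \<in> E \<Longrightarrow> y \<in> E \<Longrightarrow> free {x, y}" and "free {}"
    and D: "\<And>D. D \<in> \<D> \<Longrightarrow> D \<subseteq> V \<and> slack D \<le> 1"
  shows "card (\<Union>D\<in>\<D>. inner D) \<le> card (\<Union>\<D> - E)"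
proof -
  define G where "G = \<Union>\<D>"
  define Z where "Z = slack_hull 0 {}"
  define C where "C x = slack_hull 1 {x}" for x
  have GV: "G \<subseteq> V" using D by (auto simp: G_def)
  have nonneg: "0 \<le> slack X" if "X \<subseteq> V" for X
    using freeD[OF \<open>free {}\<close>, of X] that by simp
  have Z: "Z \<subseteq> V" "slack Z \<le> 0"
    using slack_hull_props[of "{}" "{}" 0] nonneg unfolding Z_def by (auto simp: slack_def)
  have Z_upper: "X \<subseteq> Z" if "X \<subseteq> V" "slack X \<le> 0" for X
    using slack_hull_upper[of "{}" X 0] that by (simp add: Z_def)
  have C: "x \<in> C x" "C x \<subseteq> V" "slack (C x) \<le> 1" if "x \<in> V - Z" for x
  proof -
    have "1 \<le> slack Y" if "{x} \<subseteq> Y" "Y \<subseteq> V" for Y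
      using Z_upper[of Y] that \<open>x \<in> V - Z\<close> by force
    moreover have "slack {x} \<le> 1" by (simp add: slack_def)
    ultimately show "x \<in> C x" "C x \<subseteq> V" "slack (C x) \<le> 1"
      using slack_hull_props[of "{x}" "{x}" 1] that by (auto simp: C_def)
  qed
  have C_upper: "X \<subseteq> C x" if "x \<in> X" "X \<subseteq> V" "slack X \<le> 1" for x X
    using slack_hull_upper[of "{x}" X 1] that by (simp add: C_def)
  \<comment> \<open>Maximality of hulls gives \<open>C x \<subseteq> C w\<close>, hence
    \<open>x \<in> C w\<close>, and then the reverse inclusion. This is the disjointness of the
    classes outside \<open>Z\<close>.\<close>
  have C_eq: "C x = C w" if "x \<in> V - Z" "w \<in> C x - Z" for x w
  proof -
    have w: "w \<in> V - Z" using that C by blast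
    have "C x \<subseteq> C w" using that C by (intro C_upper) auto
    moreover from this have "C w \<subseteq> C x" using C that w by (intro C_upper) auto
    ultimately show ?thesis by simp
  qed
  have EZ: "E \<inter> Z = {}"
  proof -
    have False if "e \<in> E" "e \<in> Z" for e
      using freeD[OF pairs[OF that(1) that(1)], of Z] Z that by simp
    then show ?thesis by blast
  qed
  define \<C> where "\<C> = C ` (G - Z)"
  have \<C>: "\<exists>x \<in> V - Z. c = C x" if "c \<in> \<C>" for c using that GV by (auto simp: \<C>_def)
  have finC: "finite \<C>" using GV by (simp add: \<C>_def)
  \<comment> \<open>A member of the union with a point outside \<open>Z\<close> lies in the class of
    that point, as its slack is at most 1. Sets inside \<open>Z\<close>, possibly shared by several
    classes, are counted separately.\<close>
  have cover: "(\<Union>D\<in>\<D>. inner D) \<subseteq> inner (Z \<inter> G) \<union> (\<Union>c\<in>\<C>. inner (c \<inter> G) - inner Z)"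
  proof
    fix j assume "j \<in> (\<Union>D\<in>\<D>. inner D)"
    then obtain D' where D': "D' \<in> \<D>" "j \<in> J" "A j \<subseteq> D'" by (auto simp: inner_def)
    then have DG: "D' \<subseteq> G" by (auto simp: G_def)
    show "j \<in> inner (Z \<inter> G) \<union> (\<Union>c\<in>\<C>. inner (c \<inter> G) - inner Z)"
    proof (cases "A j \<subseteq> Z")
      case True
      then show ?thesis using D' DG by (auto simp: inner_def)
    next
      case False
      then obtain x where x: "x \<in> D' - Z" using D' by blast
      then have "D' \<subseteq> C x" using D[OF D'(1)] by (intro C_upper) auto
      then show ?thesis using x D' DG False by (auto simp: inner_def \<C>_def)
    qed
  qed
  have bound_C: "card (inner (c \<inter> G) - inner Z) \<le> card (c \<inter> G - Z - E)" if c: "c \<in> \<C>" for c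
  proof -
    obtain x where "x \<in> V - Z" "c = C x" using \<C>[OF c] by blast
    then have cV: "c \<subseteq> V" and cs: "slack c \<le> 1" using C by auto
    let ?P = "c \<inter> G" and ?U = "c \<inter> G \<union> Z"
    have UV: "?U \<subseteq> V" using cV Z by auto
    \<comment> \<open>\<open>Z\<close> is adjoined so that its points and sets can be subtracted
      again below. Two points of \<open>E\<close> in one class would force slack 2, so the left side
      is 0 or 1, and freeness of the empty set or of one point suffices.\<close>
    have "int (card (?P \<inter> E)) \<le> slack ?U"
    proof (cases "?P \<inter> E = {}")
      case True
      then show ?thesis using nonneg[OF UV] by simp
    next
      case False
      then obtain e where e: "e \<in> ?P \<inter> E" by blast
      have "e' = e" if "e' \<in> ?P \<inter> E" for e'
        using freeD[OF pairs[of e e'], of c] e that cV cs by (cases "e' = e") auto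
      then have "?P \<inter> E = {e}" using e by blast
      moreover have "free {e}" using pairs[of e e] e by simp
      then have "1 \<le> slack ?U" using freeD[of "{e}" ?U] e UV by simp
      ultimately show ?thesis by simp
    qed
    then have 1: "int (card (inner ?U)) \<le> int (card ?U) - int (card (?P \<inter> E))"
      by (simp add: slack_def)
    have 2: "int (card Z) \<le> int (card (inner Z))" using Z by (simp add: slack_def)
    have "card (inner ?P - inner Z) + card (inner Z) = card (inner ?P \<union> inner Z)"
      by (simp add: card_Un_Diff)
    also have "\<dots> \<le> card (inner ?U)" by (intro card_mono) (auto simp: inner_def)
    finally have 3: "card (inner ?P - inner Z) + card (inner Z) \<le> card (inner ?U)" .
    have 4: "card ?U = card (?P - Z) + card Z"
      using UV Z(1) by (simp add: card_Un_Diff)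
    have "?P - Z = (?P - Z - E) \<union> (?P \<inter> E)" using EZ by blast
    then have 5: "card (?P - Z) = card (?P - Z - E) + card (?P \<inter> E)"
      using card_Un_disjoint[of "?P - Z - E" "?P \<inter> E"] UV by auto
    show ?thesis using 1 2 3 4 5 by linarith
  qed
  have bound_Z: "card (inner (Z \<inter> G)) \<le> card (Z \<inter> G)"
    using nonneg[of "Z \<inter> G"] GV by (auto simp: slack_def)
  have disj: "(c \<inter> G - Z - E) \<inter> (c' \<inter> G - Z - E) = {}"
    if c: "c \<in> \<C>" "c' \<in> \<C>" "c \<noteq> c'" for c c'
  proof -
    obtain x x' where x: "x \<in> V - Z" "c = C x" "x' \<in> V - Z" "c' = C x'"
      using \<C> c by blast
    have "c = C w" "c' = C w" if "w \<in> c - Z" "w \<in> c' - Z" for w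
      using C_eq[of x w] C_eq[of x' w] that x by blast+
    then show ?thesis using c(3) by blast
  qed
  have "card (\<Union>D\<in>\<D>. inner D) \<le> card (inner (Z \<inter> G) \<union> (\<Union>c\<in>\<C>. inner (c \<inter> G) - inner Z))"
    using cover finC by (intro card_mono) auto
  also have "\<dots> \<le> card (inner (Z \<inter> G)) + card (\<Union>c\<in>\<C>. inner (c \<inter> G) - inner Z)"
    by (rule card_Un_le)
  also have "\<dots> \<le> card (Z \<inter> G) + (\<Sum>c\<in>\<C>. card (inner (c \<inter> G) - inner Z))"
    using bound_Z card_UN_le[OF finC] by (rule add_mono)
  also have "\<dots> \<le> card (Z \<inter> G) + (\<Sum>c\<in>\<C>. card (c \<inter> G - Z - E))"
    using bound_C by (intro add_left_mono sum_mono)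
  also have "(\<Sum>c\<in>\<C>. card (c \<inter> G - Z - E)) = card (\<Union>c\<in>\<C>. c \<inter> G - Z - E)"
    using disj GV finC by (intro card_UN_disjoint[symmetric]) auto
  also have "card (Z \<inter> G) + \<dots> = card (Z \<inter> G \<union> (\<Union>c\<in>\<C>. c \<inter> G - Z - E))"
    using GV finC by (intro card_Un_disjoint[symmetric]) auto
  also have "\<dots> \<le> card (G - E)"
    using GV EZ by (intro card_mono) auto
  finally show ?thesis unfolding G_def .
qed

end

section \<open>Lines\<close>

text \<open>Adding \<open>e\<close> matches the sets avoiding \<open>e\<close> with those containing
  it. The same indices are inside and only one point is new, so the slack shifts by exactly
  1.\<close>

lemma (in set_family) free_contract:
  assumes "e \<in> V" "I \<subseteq> V - {e}"
  shows "set_family.free (V - {e}) J (\<lambda>j. A j - {e}) I \<longleftrightarrow> free (insert e I)"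
proof -
  interpret c: set_family "V - {e}" J "\<lambda>j. A j - {e}" by standard simp_all
  have I: "finite I" "e \<notin> I" using assms finite_subset[OF _ finite_V, of I] by auto
  have slack: "c.slack L = slack (insert e L) - 1" if "L \<subseteq> V - {e}" for L
  proof -
    have "c.inner L = inner (insert e L)" by (auto simp: inner_def c.inner_def)
    moreover have "finite L" "e \<notin> L" using that finite_subset[OF _ finite_V, of L] by auto
    ultimately show ?thesis by (simp add: slack_def c.slack_def)
  qed
  show ?thesis
  proof
    assume l: "c.free I"
    show "free (insert e I)"
      unfolding free_def
    proof (intro conjI allI impI)
      show "insert e I \<subseteq> V" using assms by blast
      fix L assume L: "insert e I \<subseteq> L" "L \<subseteq> V"
      then have "insert e (L - {e}) = L" "I \<subseteq> L - {e}" "L - {e} \<subseteq> V - {e}"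
        using I by auto
      then show "int (card (insert e I)) \<le> slack L"
        using c.freeD[OF l, of "L - {e}"] slack[of "L - {e}"] I by simp
    qed
  next
    assume r: "free (insert e I)"
    show "c.free I"
      unfolding c.free_def
    proof (intro conjI allI impI)
      show "I \<subseteq> V - {e}" using assms by blast
      fix L assume L: "I \<subseteq> L" "L \<subseteq> V - {e}"
      then have "insert e I \<subseteq> insert e L" "insert e L \<subseteq> V" using assms by auto
      then show "int (card I) \<le> c.slack L"
        using freeD[OF r, of "insert e L"] slack[OF L(2)] I by simp
    qed
  qed
qed

text \<open>In \<open>free_pair\<close>, the case \<open>x = y\<close> rules out loops and distinct
  points rule out parallel pairs. Elements of \<open>V - E\<close> are auxiliary: they are not
  points of the matroid but contribute to slacks.\<close>

locale simple_points = set_family V J A for V :: "'v set" and J :: "'j set" and A +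
  fixes E :: "'v set"
  assumes E_subset: "E \<subseteq> V" and E_nonempty: "E \<noteq> {}"
    and free_pair: "x \<in> E \<Longrightarrow> y \<in> E \<Longrightarrow> free {x, y}"
begin

text \<open>The traces \<open>L \<inter> E\<close> are the lines of the matroid on \<open>E\<close>.
  The whole hull in \<open>V\<close> is kept because the sets of the family inside it may involve
  points outside \<open>E\<close>.\<close>

definition flats :: "'v set set" where
  "flats = {slack_hull 2 {a, b} | a b. a \<in> E \<and> b \<in> E \<and> a \<noteq> b}"

section \<open>Flats as lines: incidence properties\<close>

lemma finite_E [simp]: "finite E"
  using E_subset by simp

lemma free_empty: "free {}"
  using free_subset free_pair E_nonempty by blast

lemma slack_hull_pair:
  assumes "a \<in> E" "b \<in> E" "a \<noteq> b"
  shows "{a, b} \<subseteq> slack_hull 2 {a, b} \<and> slack_hull 2 {a, b} \<subseteq> V \<and> slack (slack_hull 2 {a, b}) \<le> 2"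
proof (rule slack_hull_props)
  show "{a, b} \<subseteq> {a, b}" "{a, b} \<subseteq> V" using assms E_subset by auto
  show "slack {a, b} \<le> 2" using assms by (simp add: slack_def)
  fix Y assume "{a, b} \<subseteq> Y" "Y \<subseteq> V"
  then show "2 \<le> slack Y" using freeD[OF free_pair[OF assms(1,2)], of Y] assms(3) by simp
qed

lemma slack_hull_pair_flat: "a \<in> E \<Longrightarrow> b \<in> E \<Longrightarrow> a \<noteq> b \<Longrightarrow> slack_hull 2 {a, b} \<in> flats"
  by (auto simp: flats_def)

lemma flat_subset: "L \<in> flats \<Longrightarrow> L \<subseteq> V"
  and slack_flat: "L \<in> flats \<Longrightarrow> slack L \<le> 2"
  using slack_hull_pair by (auto simp: flats_def)

lemma finite_flats [simp]: "finite flats"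
  by (rule finite_subset[of _ "Pow V"]) (auto dest: flat_subset)

text \<open>Maximality holds relative to any two points of \<open>E\<close> on the flat, not only
  the defining pair: the hull of \<open>a\<close>, \<open>b\<close> contains \<open>L\<close>, hence
  the defining pair, and so is itself contained in \<open>L\<close>.\<close>

lemma flat_upper:
  assumes "L \<in> flats" "X \<subseteq> V" "slack X \<le> 2" "a \<in> E \<inter> L \<inter> X" "b \<in> E \<inter> L \<inter> X" "a \<noteq> b"
  shows "X \<subseteq> L"
proof -
  obtain c d where cd: "L = slack_hull 2 {c, d}" "c \<in> E" "d \<in> E" "c \<noteq> d"
    using assms(1) by (auto simp: flats_def)
  have ab: "a \<in> E" "b \<in> E" using assms by auto
  have "L \<subseteq> slack_hull 2 {a, b}"
    using assms flat_subset slack_flat by (intro slack_hull_upper) auto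
  then have "{c, d} \<subseteq> slack_hull 2 {a, b}" using cd(1) slack_hull_pair[OF cd(2-4)] by blast
  then have "slack_hull 2 {a, b} \<subseteq> L"
    using slack_hull_pair[OF ab assms(6)] cd(1)
      slack_hull_upper[of "{c, d}" "slack_hull 2 {a, b}" 2] by simp
  moreover have "X \<subseteq> slack_hull 2 {a, b}" using assms by (intro slack_hull_upper) auto
  ultimately show ?thesis by blast
qed

lemma flat_eqI:
  assumes "L \<in> flats" "L' \<in> flats" "a \<in> E" "b \<in> E" "a \<noteq> b" "{a, b} \<subseteq> L" "{a, b} \<subseteq> L'"
  shows "L = L'"
  using assms flat_upper[of L L' a b] flat_upper[of L' L a b] flat_subset slack_flat by auto

lemma flat_points:
  assumes "L \<in> flats"
  obtains a b where "a \<in> E" "b \<in> E" "a \<noteq> b" "{a, b} \<subseteq> L"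
  using assms slack_hull_pair unfolding flats_def by blast

lemma two_le_card_flat:
  assumes "L \<in> flats"
  shows "2 \<le> card (L \<inter> E)"
proof -
  obtain a b where "a \<in> E" "b \<in> E" "a \<noteq> b" "{a, b} \<subseteq> L" using flat_points[OF assms] .
  then show ?thesis using card_mono[of "L \<inter> E" "{a, b}"] by auto
qed

lemma not_free_triple:
  assumes "L \<in> flats" "X \<subseteq> L" "card X = 3"
  shows "\<not> free X"
  using freeD[of X L] flat_subset slack_flat assms by fastforce

text \<open>A set violating freeness would have slack at most 2, hence lie inside the hull of
  \<open>x\<close> and \<open>y\<close>, which misses \<open>z\<close>.\<close>

lemma free_triple:
  assumes "x \<in> E" "y \<in> E" "z \<in> E" "x \<noteq> y" "z \<notin> slack_hull 2 {x, y}"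
  shows "free {x, y, z}"
  unfolding free_def
proof (intro conjI allI impI)
  show "{x, y, z} \<subseteq> V" using assms E_subset by auto
  fix L assume L: "{x, y, z} \<subseteq> L" "L \<subseteq> V"
  have "\<not> slack L \<le> 2"
    using slack_hull_upper[of "{x, y}" L 2] L assms by auto
  moreover have "card {x, y, z} \<le> 3" by (simp add: card_insert_if)
  ultimately show "int (card {x, y, z}) \<le> slack L" by linarith
qed

text \<open>The union has slack at least 3, since otherwise maximality would put each flat inside
  the other. Submodularity leaves at most \<open>2 + 2 - 3\<close> for the intersection.\<close>

lemma slack_flat_Int:
  assumes "L \<in> flats" "L' \<in> flats" "L \<noteq> L'"
  shows "slack (L \<inter> L') \<le> 1"
proof -
  have LV: "L \<subseteq> V" "L' \<subseteq> V" using assms flat_subset by auto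
  obtain a b where ab: "a \<in> E" "b \<in> E" "a \<noteq> b" "{a, b} \<subseteq> L" using flat_points[OF assms(1)] .
  obtain c d where cd: "c \<in> E" "d \<in> E" "c \<noteq> d" "{c, d} \<subseteq> L'" using flat_points[OF assms(2)] .
  have "\<not> slack (L \<union> L') \<le> 2"
  proof
    assume s: "slack (L \<union> L') \<le> 2"
    have "L \<union> L' \<subseteq> L" using ab s LV by (intro flat_upper[OF assms(1)]) auto
    moreover have "L \<union> L' \<subseteq> L'" using cd s LV by (intro flat_upper[OF assms(2)]) auto
    ultimately show False using assms(3) by blast
  qed
  then show ?thesis
    using slack_submodular[OF LV] slack_flat[OF assms(1)] slack_flat[OF assms(2)] by linarith
qed

text \<open>Flats are added one at a time, and the left side, initially \<open>card E\<close>, never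
  increases. A flat \<open>L\<close> satisfies \<open>card L - card (inner L) \<le> 2\<close>, and
  at most as many of its sets were counted before as it has old points outside
  \<open>E\<close>.\<close>

lemma card_Union_flats_le:
  assumes "\<G> \<subseteq> flats"
  shows "int (card (E \<union> \<Union>\<G>)) - int (card (\<Union>L\<in>\<G>. inner L))
    + (\<Sum>L\<in>\<G>. int (card (L \<inter> E)) - 2) \<le> int (card E)"
proof -
  have "finite \<G>" using assms finite_flats finite_subset by blast
  then show ?thesis using assms
  proof (induction \<G> rule: finite_induct)
    case (insert L \<G>)
    let ?U = "\<Union>\<G>" and ?K = "\<Union>L\<in>\<G>. inner L"
    have L: "L \<in> flats" "L \<subseteq> V" and G: "\<G> \<subseteq> flats" using insert flat_subset by auto
    have UV: "?U \<subseteq> V" using G flat_subset by auto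
    have finK: "finite ?K" by (rule finite_subset[OF _ finite_J]) (auto simp: inner_def)
    have D: "D \<subseteq> V \<and> slack D \<le> 1" if "D \<in> (\<inter>) L ` \<G>" for D
      using that insert.hyps(2) L G slack_flat_Int[OF L(1)] by auto
    \<comment> \<open>Sets counted twice lie in intersections with earlier flats. These have slack
      at most 1, so the count by parallel classes applies.\<close>
    have "inner L \<inter> ?K = (\<Union>D\<in>(\<inter>) L ` \<G>. inner D)"
      by (auto simp: inner_def)
    also have "card \<dots> \<le> card (\<Union>((\<inter>) L ` \<G>) - E)"
      using card_inner_Union_le[OF E_subset free_pair free_empty D] by blast
    also have "\<Union>((\<inter>) L ` \<G>) - E = L \<inter> ?U - E" by auto
    finally have 1: "card (inner L \<inter> ?K) \<le> card (L \<inter> ?U - E)" .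
    have 2: "card (inner L) + card ?K = card (inner L \<union> ?K) + card (inner L \<inter> ?K)"
      using finK by (intro card_Un_Int) auto
    have 3: "card (E \<union> (L \<union> ?U)) = card (L - (E \<union> ?U)) + card (E \<union> ?U)"
      using card_Un_Diff[of L "E \<union> ?U"] L UV by (simp add: Un_left_commute)
    have "L = (L - (E \<union> ?U)) \<union> ((L \<inter> ?U - E) \<union> (L \<inter> E))" by blast
    moreover have "card ((L - (E \<union> ?U)) \<union> ((L \<inter> ?U - E) \<union> (L \<inter> E)))
        = card (L - (E \<union> ?U)) + card ((L \<inter> ?U - E) \<union> (L \<inter> E))"
      using L by (intro card_Un_disjoint) (auto intro: finite_subset[OF _ finite_V])
    moreover have "card ((L \<inter> ?U - E) \<union> (L \<inter> E)) = card (L \<inter> ?U - E) + card (L \<inter> E)"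
      using L by (intro card_Un_disjoint) (auto intro: finite_subset[OF _ finite_V])
    ultimately have 4: "card L = card (L - (E \<union> ?U)) + card (L \<inter> ?U - E) + card (L \<inter> E)"
      by simp
    have 5: "int (card L) - int (card (inner L)) \<le> 2"
      using slack_flat[OF L(1)] by (simp add: slack_def)
    have "(\<Sum>L\<in>insert L \<G>. int (card (L \<inter> E)) - 2)
        = int (card (L \<inter> E)) - 2 + (\<Sum>L\<in>\<G>. int (card (L \<inter> E)) - 2)"
      using insert.hyps by simp
    then show ?case using 1 2 3 4 5 insert.IH[OF G] by simp
  qed simp
qed

text \<open>\<open>E\<close> together with all flats contains the free set \<open>I\<close>, so its
  slack is at least \<open>card I\<close>; this enters \<open>card_Union_flats_le\<close> taken for
  all flats.\<close>

lemma sum_flats_le: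
  assumes "I \<subseteq> E" "free I"
  shows "(\<Sum>L\<in>flats. int (card (L \<inter> E)) - 2) \<le> int (card E) - int (card I)"
proof -
  let ?W = "E \<union> \<Union>flats"
  have W: "?W \<subseteq> V" using E_subset flat_subset by auto
  have "int (card I) \<le> slack ?W" using assms W by (intro freeD) auto
  moreover have "card (\<Union>L\<in>flats. inner L) \<le> card (inner ?W)"
    by (intro card_mono) (auto simp: inner_def)
  ultimately show ?thesis
    using card_Union_flats_le[of flats] unfolding slack_def by simp
qed

section \<open>Counting incidences between points and lines\<close>

lemma card_E_eq:
  assumes "e \<in> E"
  shows "card E = 1 + (\<Sum>L | L \<in> flats \<and> e \<in> L. card (L \<inter> E) - 1)"
proof -
  let ?F = "{L. L \<in> flats \<and> e \<in> L}"
  have "E - {e} = (\<Union>L\<in>?F. L \<inter> E - {e})"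
  proof
    show "E - {e} \<subseteq> (\<Union>L\<in>?F. L \<inter> E - {e})"
    proof
      fix x assume "x \<in> E - {e}"
      then show "x \<in> (\<Union>L\<in>?F. L \<inter> E - {e})"
        using assms slack_hull_pair[of e x] slack_hull_pair_flat[of e x] by auto
    qed
  qed auto
  also have "card \<dots> = (\<Sum>L\<in>?F. card (L \<inter> E - {e}))"
  proof (rule card_UN_disjoint)
    show "\<forall>L\<in>?F. \<forall>L'\<in>?F. L \<noteq> L' \<longrightarrow> (L \<inter> E - {e}) \<inter> (L' \<inter> E - {e}) = {}"
    proof (intro ballI impI)
      fix L L' assume "L \<in> ?F" "L' \<in> ?F" "L \<noteq> L'"
      then have "\<not> (x \<in> E \<and> x \<noteq> e \<and> x \<in> L \<and> x \<in> L')" for x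
        using flat_eqI[of L L' e x] assms by auto
      then show "(L \<inter> E - {e}) \<inter> (L' \<inter> E - {e}) = {}" by blast
    qed
  qed auto
  also have "\<dots> = (\<Sum>L\<in>?F. card (L \<inter> E) - 1)"
    using assms by (intro sum.cong) auto
  finally show ?thesis using card_Suc_Diff1[OF finite_E assms] by simp
qed

text \<open>Choosing one point other than \<open>e\<close> on each line through \<open>e\<close>
  represents the parallel classes after contraction of \<open>e\<close>. Different choices are never
  on a common line with \<open>e\<close>, so contraction keeps the chosen points simple.\<close>

lemma ex_transversal:
  assumes "e \<in> E"
  obtains E' where "E' \<subseteq> E - {e}" "card E' = card {L \<in> flats. e \<in> L}"
    "\<And>x y. x \<in> E' \<Longrightarrow> y \<in> E' \<Longrightarrow> free {e, x, y}"
proof -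
  let ?F = "{L \<in> flats. e \<in> L}"
  have "\<forall>L\<in>?F. \<exists>x. x \<in> L \<inter> E - {e}"
  proof
    fix L assume "L \<in> ?F"
    then obtain a b where "a \<in> E" "b \<in> E" "a \<noteq> b" "{a, b} \<subseteq> L"
      using flat_points[of L] by auto
    then show "\<exists>x. x \<in> L \<inter> E - {e}" by (cases "a = e") auto
  qed
  then obtain f where "\<forall>L\<in>?F. f L \<in> L \<inter> E - {e}"
    using bchoice[of ?F] by meson
  then have f: "f L \<in> L \<inter> E - {e}" if "L \<in> ?F" for L using that by simp
  have eq: "L = L'" if "L \<in> ?F" "L' \<in> ?F" "f L \<in> L'" for L L'
    using that f[OF that(1)] assms by (intro flat_eqI[of L L' e "f L"]) auto
  have inj: "inj_on f ?F"
  proof (rule inj_onI)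
    fix L L' assume L: "L \<in> ?F" "L' \<in> ?F" "f L = f L'"
    then show "L = L'" using f[OF L(2)] by (intro eq) auto
  qed
  show thesis
  proof
    show "f ` ?F \<subseteq> E - {e}" using f by blast
    show "card (f ` ?F) = card ?F" using inj by (rule card_image)
    fix x y assume "x \<in> f ` ?F" "y \<in> f ` ?F"
    then obtain L L' where L: "L \<in> ?F" "x = f L" "L' \<in> ?F" "y = f L'" by blast
    have x: "x \<in> E" "x \<noteq> e" and y: "y \<in> E" "y \<noteq> e" using f L by auto
    show "free {e, x, y}"
    proof (cases "x = y")
      case True
      then show ?thesis using free_pair assms x by simp
    next
      case False
      have "slack_hull 2 {e, x} = L"
        using f[OF L(1)] L x assms slack_hull_pair[OF assms x(1)]
          slack_hull_pair_flat[OF assms x(1)]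
        by (intro flat_eqI[of _ _ e x]) auto
      moreover have "y \<notin> L" using eq[of L' L] L False by auto
      ultimately show ?thesis using free_triple[of e x y] assms x y by auto
    qed
  qed
qed

lemma sum_flats_through:
  assumes "e \<in> E"
  shows "(\<Sum>L | L \<in> flats \<and> e \<in> L. int (card (L \<inter> E)) - 2)
    = int (card E) - 1 - int (card {L \<in> flats. e \<in> L})"
proof -
  let ?F = "{L \<in> flats. e \<in> L}"
  have "int (card E) = 1 + (\<Sum>L\<in>?F. int (card (L \<inter> E) - 1))"
    by (subst card_E_eq[OF assms]) simp
  also have "(\<Sum>L\<in>?F. int (card (L \<inter> E) - 1)) = (\<Sum>L\<in>?F. (int (card (L \<inter> E)) - 2) + 1)"
    by (intro sum.cong refl) (use two_le_card_flat in force)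
  also have "\<dots> = (\<Sum>L\<in>?F. int (card (L \<inter> E)) - 2) + int (card ?F)"
    by (simp only: sum.distrib) simp
  finally show ?thesis by linarith
qed

text \<open>Double counting: each flat contributes once for every point of \<open>E\<close> on
  it.\<close>

lemma sum_sum_flats:
  "(\<Sum>e\<in>E. \<Sum>L | L \<in> flats \<and> e \<in> L. int (card (L \<inter> E)) - 2)
    = (\<Sum>L\<in>flats. int (card (L \<inter> E)) * (int (card (L \<inter> E)) - 2))"
proof -
  have "(\<Sum>e\<in>E. \<Sum>L | L \<in> flats \<and> e \<in> L. int (card (L \<inter> E)) - 2)
      = (\<Sum>L\<in>flats. \<Sum>e | e \<in> E \<and> e \<in> L. int (card (L \<inter> E)) - 2)"
    by (rule sum.swap_restrict) simp_all
  also have "\<dots> = (\<Sum>L\<in>flats. int (card (L \<inter> E)) * (int (card (L \<inter> E)) - 2))"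
    by (intro sum.cong refl) (simp add: Collect_conj_eq Int_commute)
  finally show ?thesis .
qed

text \<open>Either contraction of some \<open>e\<close> is still too dense for rank
  \<open>r - 1\<close>, or some line is already too long. If both fail, the sum of
  \<open>card (L \<inter> E) - 2\<close> over incidences is large because few lines pass through
  each point, yet small because lines are short and \<open>sum_flats_le\<close> holds.\<close>

lemma dense_imp_flat_or_point:
  assumes "1 \<le> l" "2 \<le> r" and I: "I \<subseteq> E" "free I" "card I = r"
    and dense: "l * (r - 1) + 2 \<le> card E"
  shows "(\<exists>e\<in>E. l * (r - 2) + 2 \<le> card {L \<in> flats. e \<in> L}) \<or> (\<exists>L\<in>flats. l + 2 \<le> card (L \<inter> E))"
proof (rule ccontr)
  assume neg: "\<not> ?thesis"
  \<comment> \<open>The counts are moved to the integers to avoid truncated subtraction.\<close>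
  define n where "n = int (card E)"
  define m where "m = int l"
  define q where "q = int r"
  let ?w = "\<lambda>L. int (card (L \<inter> E)) - 2"
  have mq: "1 \<le> m" "2 \<le> q" using assms by (simp_all add: m_def q_def)
  have "int (l * (r - 1) + 2) \<le> n" using dense by (simp only: n_def of_nat_le_iff)
  then have n: "m * (q - 1) + 2 \<le> n" using assms(2) by (simp add: m_def q_def of_nat_diff)
  have e: "n - 2 - m * (q - 2) \<le> (\<Sum>L | L \<in> flats \<and> e \<in> L. ?w L)" if "e \<in> E" for e
  proof -
    have "card {L \<in> flats. e \<in> L} \<le> l * (r - 2) + 1" using neg that by force
    then have "int (card {L \<in> flats. e \<in> L}) \<le> int (l * (r - 2) + 1)" by (simp only: of_nat_le_iff)
    then have "int (card {L \<in> flats. e \<in> L}) \<le> m * (q - 2) + 1"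
      using assms(2) by (simp add: m_def q_def of_nat_diff)
    then show ?thesis unfolding sum_flats_through[OF that] n_def by linarith
  qed
  have "n * (n - 2 - m * (q - 2)) = (\<Sum>e\<in>E. n - 2 - m * (q - 2))" by (simp add: n_def)
  also have "\<dots> \<le> (\<Sum>e\<in>E. \<Sum>L | L \<in> flats \<and> e \<in> L. ?w L)" using e by (intro sum_mono)
  also have "\<dots> = (\<Sum>L\<in>flats. int (card (L \<inter> E)) * ?w L)" by (rule sum_sum_flats)
  also have "\<dots> \<le> (\<Sum>L\<in>flats. (m + 1) * ?w L)"
  proof (intro sum_mono mult_right_mono)
    fix L assume L: "L \<in> flats"
    then have "card (L \<inter> E) \<le> l + 1" using neg by force
    then show "int (card (L \<inter> E)) \<le> m + 1" by (simp add: m_def)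
    show "0 \<le> ?w L" using two_le_card_flat[OF L] by simp
  qed
  also have "\<dots> = (m + 1) * (\<Sum>L\<in>flats. ?w L)" by (simp add: sum_distrib_left)
  also have "\<dots> \<le> (m + 1) * (n - q)"
    using sum_flats_le[OF I(1,2)] I(3) mq by (intro mult_left_mono) (simp_all add: n_def q_def)
  finally have le: "n * (n - 2 - m * (q - 2)) \<le> (m + 1) * (n - q)" .
  have n0: "0 \<le> n" by (simp add: n_def)
  \<comment> \<open>\<open>t\<close> is the excess of \<open>n\<close> over the least dense size, so
    the factor in \<open>le\<close> is \<open>m + t\<close>. For \<open>t = 0\<close> this yields
    \<open>(m + 1) * q \<le> m * (q - 1) + 2\<close>, that is \<open>q + m \<le> 2\<close>; for
    \<open>t \<ge> 1\<close>, lowering the factor to \<open>m + 1\<close> already yields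
    \<open>(m + 1) * q \<le> 0\<close>.\<close>
  define t where "t = n - 2 - m * (q - 1)"
  have t: "0 \<le> t" using n by (simp add: t_def)
  have nt: "n - 2 - m * (q - 2) = m + t" by (simp add: t_def algebra_simps)
  show False
  proof (cases "t = 0")
    case True
    then have "n * m \<le> (m + 1) * (n - q)" using le nt by simp
    then have "(m + 1) * q \<le> n" by (simp add: algebra_simps)
    moreover have "n = m * (q - 1) + 2" using True by (simp add: t_def)
    ultimately show False using mq by (simp add: algebra_simps)
  next
    case False
    then have "n * (m + 1) \<le> n * (m + t)" using t n0 by (intro mult_left_mono) auto
    then have "n * (m + 1) \<le> (m + 1) * (n - q)" using le nt by simp
    then have "(m + 1) * q \<le> 0" by (simp add: algebra_simps)
    moreover have "0 < (m + 1) * q" using mq by simp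
    ultimately show False by simp
  qed
qed

end

text \<open>Contracting \<open>F\<close> and restricting to \<open>Q\<close> gives a uniform matroid
  of rank 2 on \<open>l + 2\<close> points. \<open>r\<close> is only an upper bound for the rank,
  and \<open>V\<close>, \<open>A\<close>, \<open>E\<close> vary in the induction because contraction
  changes all three.\<close>

theorem ex_dense_line:
  fixes V :: "'v set" and J :: "'j set"
  assumes "set_family V J" "E \<subseteq> V" "1 \<le> l"
    and "\<And>x y. x \<in> E \<Longrightarrow> y \<in> E \<Longrightarrow> set_family.free V J A {x, y}"
    and "\<And>I. I \<subseteq> E \<Longrightarrow> set_family.free V J A I \<Longrightarrow> card I \<le> r"
    and "l * (r - 1) + 2 \<le> card E"
  shows "\<exists>F Q. F \<subseteq> E \<and> Q \<subseteq> E - F \<and> card Q = l + 2 \<and>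
    (\<forall>x\<in>Q. \<forall>y\<in>Q. set_family.free V J A (F \<union> {x, y})) \<and>
    (\<forall>X\<subseteq>Q. card X = 3 \<longrightarrow> \<not> set_family.free V J A (F \<union> X))"
  using assms
proof (induction r arbitrary: V A E rule: less_induct)
  case (less r)
  interpret set_family V J A by (rule less.prems)
  note free_pair = less.prems(4) and rank = less.prems(5) and dense = less.prems(6)
  have "E \<noteq> {}" using dense by auto
  then interpret simple_points V J A E
    using less.prems by unfold_locales auto
  let ?P = "\<lambda>I. I \<subseteq> E \<and> free I"
  have "?P {}" using free_empty by simp
  moreover have "\<forall>I. ?P I \<longrightarrow> card I < Suc r" using rank by (simp add: less_Suc_eq_le)
  ultimately obtain I where I: "?P I" "\<forall>I'. ?P I' \<longrightarrow> card I' \<le> card I"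
    using ex_has_greatest_nat[of ?P "{}" card "Suc r"] by blast
  \<comment> \<open>Density provides two points, so the rank is at least 2 and \<open>r - 2\<close>
    below is not truncated.\<close>
  obtain x y where xy: "x \<in> E" "y \<in> E" "x \<noteq> y"
    using dense card_le_Suc0_iff_eq[of E] by fastforce
  then have "card {x, y} \<le> card I" using I(2)[rule_format, of "{x, y}"] free_pair[of x y] by blast
  then have two: "2 \<le> card I" using xy by simp
  show ?case
  proof (cases "card I < r")
    case True
    \<comment> \<open>The density condition weakens as the rank bound decreases, so the actual rank
      may replace \<open>r\<close>.\<close>
    moreover have "l * (card I - 1) + 2 \<le> card E"
      using dense True mult_le_mono2[of "card I - 1" "r - 1" l] by linarith
    ultimately show ?thesis
      using less.prems I(2) by (intro less.IH) auto
  next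
    case False
    then have Ir: "card I = r" using rank I(1) by (simp add: le_antisym)
    have r: "2 \<le> r" using two Ir by simp
    consider (point) e where "e \<in> E" "l * (r - 2) + 2 \<le> card {L \<in> flats. e \<in> L}"
      | (flat) L where "L \<in> flats" "l + 2 \<le> card (L \<inter> E)"
      using dense_imp_flat_or_point[OF less.prems(3) r _ _ Ir dense] I(1) by blast
    then show ?thesis
    proof cases
      case point
      obtain E' where E': "E' \<subseteq> E - {e}" "card E' = card {L \<in> flats. e \<in> L}"
        "\<And>x y. x \<in> E' \<Longrightarrow> y \<in> E' \<Longrightarrow> free {e, x, y}"
        by (rule ex_transversal[OF point(1)]) (rule that)
      have eV: "e \<in> V" and E'V: "E' \<subseteq> V - {e}" using point E' E_subset by auto
      let ?free = "set_family.free (V - {e}) J (\<lambda>j. A j - {e})"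
      have iff: "?free X \<longleftrightarrow> free (insert e X)" if "X \<subseteq> E'" for X
        using free_contract[OF eV, of X] that E'V by auto
      have "\<exists>F Q. F \<subseteq> E' \<and> Q \<subseteq> E' - F \<and> card Q = l + 2 \<and>
        (\<forall>x\<in>Q. \<forall>y\<in>Q. ?free (F \<union> {x, y})) \<and> (\<forall>X\<subseteq>Q. card X = 3 \<longrightarrow> \<not> ?free (F \<union> X))"
      proof (rule less.IH[of "r - 1"])
        show "set_family (V - {e}) J" by standard simp_all
        show "?free {x, y}" if "x \<in> E'" "y \<in> E'" for x y
          using E'(3)[OF that] that by (subst iff) auto
        \<comment> \<open>Adding \<open>e\<close> to a set that is free after contraction gives a
          free set with one more element.\<close>
        show "card X \<le> r - 1" if X: "X \<subseteq> E'" "?free X" for X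
        proof -
          have "insert e X \<subseteq> E" "e \<notin> X" "finite X"
            using X(1) E'(1) point(1) finite_subset[OF _ finite_E, of X] by auto
          then show ?thesis using rank[of "insert e X"] X iff by auto
        qed
        show "l * (r - 1 - 1) + 2 \<le> card E'"
          using point(2) E'(2) by (simp add: numeral_2_eq_2)
      qed (use r E'V less.prems in auto)
      then obtain F Q where FQ: "F \<subseteq> E'" "Q \<subseteq> E' - F" "card Q = l + 2"
        "\<And>x y. x \<in> Q \<Longrightarrow> y \<in> Q \<Longrightarrow> ?free (F \<union> {x, y})"
        "\<And>X. X \<subseteq> Q \<Longrightarrow> card X = 3 \<Longrightarrow> \<not> ?free (F \<union> X)"
        by auto
      show ?thesis
      \<comment> \<open>The configuration found after contracting \<open>e\<close> lifts once
        \<open>e\<close> joins the contracted set.\<close>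
      proof (rule exI[of _ "insert e F"], rule exI[of _ Q], intro conjI ballI allI impI)
        show "insert e F \<subseteq> E" "Q \<subseteq> E - insert e F" "card Q = l + 2"
          using FQ(1-3) E'(1) point(1) by auto
        show "free (insert e F \<union> {x, y})" if "x \<in> Q" "y \<in> Q" for x y
        proof -
          have "F \<union> {x, y} \<subseteq> E'" using FQ(1,2) that by blast
          then show ?thesis using iff[of "F \<union> {x, y}"] FQ(4)[OF that] by (simp add: insert_commute)
        qed
        show "\<not> free (insert e F \<union> X)" if "X \<subseteq> Q" "card X = 3" for X
        proof -
          have "F \<union> X \<subseteq> E'" using FQ(1,2) that by blast
          then show ?thesis using iff[of "F \<union> X"] FQ(5)[OF that] by simp
        qed
      qed
    next
      case flat
      \<comment> \<open>A long line needs no contraction, so the witness for \<open>F\<close> is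
        empty.\<close>
      obtain Q where Q: "Q \<subseteq> L \<inter> E" "card Q = l + 2"
        using obtain_subset_with_card_n[OF flat(2)] by blast
      have "free ({} \<union> {x, y})" if "x \<in> Q" "y \<in> Q" for x y
        using Q(1) free_pair[of x y] that by auto
      moreover have "\<not> free ({} \<union> X)" if "X \<subseteq> Q" "card X = 3" for X
        using not_free_triple[OF flat(1), of X] Q(1) that by auto
      moreover have "Q \<subseteq> E - {}" using Q(1) by blast
      ultimately show ?thesis using Q(2) by blast
    qed
  qed
qed

section \<open>Linkings and systems of distinct representatives\<close>

text \<open>Induction on \<open>J\<close>. If a nonempty proper subfamily \<open>K\<close> is tight,
  it is represented inside its union \<open>U\<close> and the rest outside \<open>U\<close>.
  Otherwise each such subfamily has a spare element, so any element of one set may be fixed as its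
  representative and removed from the others.\<close>

theorem hall:
  assumes "finite J" "\<And>j. j \<in> J \<Longrightarrow> finite (A j)"
    and "\<And>K. K \<subseteq> J \<Longrightarrow> card K \<le> card (\<Union>j\<in>K. A j)"
  shows "\<exists>s. inj_on s J \<and> (\<forall>j\<in>J. s j \<in> A j)"
  using assms
proof (induction J arbitrary: A rule: finite_psubset_induct)
  case (psubset J)
  note fin = psubset.prems(1) and hall = psubset.prems(2)
  have finU: "finite (\<Union>j\<in>K. A j)" if "K \<subseteq> J" for K
    using fin that psubset.hyps by (auto intro: finite_subset)
  show ?case
  proof (cases "J = {}")
    case True
    then show ?thesis by simp
  next
    case False
    show ?thesis
    proof (cases "\<exists>K. K \<noteq> {} \<and> K \<subset> J \<and> card (\<Union>j\<in>K. A j) \<le> card K")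
      case True
      then obtain K where K: "K \<noteq> {}" "K \<subset> J" "card (\<Union>j\<in>K. A j) \<le> card K" by blast
      define U where "U = (\<Union>j\<in>K. A j)"
      have finK: "finite K" using K(2) psubset.hyps finite_subset by blast
      have "\<exists>s. inj_on s K \<and> (\<forall>j\<in>K. s j \<in> A j)"
        using K(2) fin hall by (intro psubset.IH) auto
      then obtain s where s: "inj_on s K" "\<And>j. j \<in> K \<Longrightarrow> s j \<in> A j" by blast
      have "\<exists>s. inj_on s (J - K) \<and> (\<forall>j\<in>J - K. s j \<in> A j - U)"
      proof (rule psubset.IH)
        show "J - K \<subset> J" using K(1,2) by blast
        show "finite (A j - U)" if "j \<in> J - K" for j using fin that by blast
        fix K' assume K': "K' \<subseteq> J - K"
        then have finK': "finite K'" using psubset.hyps finite_subset by blast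
        \<comment> \<open>The condition for \<open>K' \<union> K\<close> is reduced by
          \<open>K\<close>, whose union has at most \<open>card K\<close> elements.\<close>
        have "card K' + card K = card (K' \<union> K)"
          using K' finK finK' by (intro card_Un_disjoint[symmetric]) auto
        also have "\<dots> \<le> card (\<Union>j\<in>K' \<union> K. A j)" using K' K(2) by (intro hall) auto
        also have "(\<Union>j\<in>K' \<union> K. A j) = (\<Union>j\<in>K'. A j - U) \<union> U" by (auto simp: U_def)
        also have "card \<dots> \<le> card (\<Union>j\<in>K'. A j - U) + card U" by (rule card_Un_le)
        finally show "card K' \<le> card (\<Union>j\<in>K'. A j - U)" using K(3) by (simp add: U_def)
      qed
      then obtain s' where s': "inj_on s' (J - K)" "\<And>j. j \<in> J - K \<Longrightarrow> s' j \<in> A j - U" by blast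
      have U: "s j \<in> U" if "j \<in> K" for j using s(2)[OF that] that by (auto simp: U_def)
      have "inj_on (\<lambda>j. if j \<in> K then s j else s' j) J"
      proof (rule inj_onI)
        fix i j
        assume "i \<in> J" "j \<in> J"
          "(if i \<in> K then s i else s' i) = (if j \<in> K then s j else s' j)"
        then show "i = j"
          using U[of i] U[of j] s'(2)[of i] s'(2)[of j] inj_onD[OF s(1), of i j]
            inj_onD[OF s'(1), of i j]
          by (cases "i \<in> K"; cases "j \<in> K") auto
      qed
      moreover have "\<forall>j\<in>J. (if j \<in> K then s j else s' j) \<in> A j" using s(2) s'(2) by auto
      ultimately show ?thesis by blast
    next
      case no_tight: False
      obtain j where j: "j \<in> J" using False by blast
      have "A j \<noteq> {}" using hall[of "{j}"] j by auto
      then obtain x where x: "x \<in> A j" by blast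
      have "\<exists>s. inj_on s (J - {j}) \<and> (\<forall>i\<in>J - {j}. s i \<in> A i - {x})"
      proof (rule psubset.IH)
        show "J - {j} \<subset> J" using j by blast
        show "finite (A i - {x})" if "i \<in> J - {j}" for i using fin that by blast
        fix K assume K: "K \<subseteq> J - {j}"
        show "card K \<le> card (\<Union>i\<in>K. A i - {x})"
        proof (cases "K = {}")
          case False
          moreover have "K \<subset> J" using K j by blast
          ultimately have "\<not> card (\<Union>i\<in>K. A i) \<le> card K" using no_tight by blast
          then have "card K < card (\<Union>i\<in>K. A i)" by simp
          also have "card (\<Union>i\<in>K. A i) \<le> Suc (card ((\<Union>i\<in>K. A i) - {x}))"
            unfolding card_Diff_singleton_if by (simp only: split: if_split) linarith
          also have "(\<Union>i\<in>K. A i) - {x} = (\<Union>i\<in>K. A i - {x})" by blast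
          finally show ?thesis by simp
        qed simp
      qed
      then obtain s where s: "inj_on s (J - {j})" "\<And>i. i \<in> J - {j} \<Longrightarrow> s i \<in> A i - {x}" by blast
      have "inj_on (s(j := x)) (insert j (J - {j}))"
        using s(1) s(2) by (force simp: inj_on_def)
      then have "inj_on (s(j := x)) J" using j by (simp add: insert_absorb)
      moreover have "\<forall>i\<in>J. (s(j := x)) i \<in> A i" using s(2) x by auto
      ultimately show ?thesis by blast
    qed
  qed
qed

text \<open>Hall's condition for a subfamily of the reduced sets is the freeness inequality for its
  union together with \<open>I\<close>.\<close>

lemma (in set_family) free_imp_ex_sdr:
  assumes "free I" and A: "\<And>j. j \<in> J \<Longrightarrow> A j \<subseteq> V"
  shows "\<exists>s. inj_on s J \<and> (\<forall>j\<in>J. s j \<in> A j - I)"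
proof (rule hall)
  have I: "I \<subseteq> V" using assms(1) by (simp add: free_def)
  show "finite (A j - I)" if "j \<in> J" for j using A[OF that] by simp
  fix K assume K: "K \<subseteq> J"
  let ?U = "\<Union>j\<in>K. A j"
  have U: "?U \<subseteq> V" using K A by blast
  have "int (card I) \<le> slack (?U \<union> I)" using assms(1) I U by (intro freeD) auto
  moreover have "card K \<le> card (inner (?U \<union> I))"
    using K by (intro card_mono) (auto simp: inner_def)
  moreover have "card (?U \<union> I) = card (?U - I) + card I"
    using I U by (intro card_Un_Diff) auto
  moreover have "card (\<Union>j\<in>K. A j - I) = card (?U - I)"
    by (rule arg_cong[of _ _ card]) blast
  ultimately show "card K \<le> card (\<Union>j\<in>K. A j - I)" unfolding slack_def by linarith
qed simp

text \<open>The closed out-neighbourhood: \<open>v\<close> is included so that a vertex off the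
  linking can represent itself.\<close>

definition (in pre_digraph) out_star :: "'a \<Rightarrow> 'a set" where
  "out_star v = insert v {head G a | a. a \<in> arcs G \<and> tail G a = v}"

section \<open>Linkings as free sets\<close>

context fin_digraph
begin

lemma out_star_subset: "v \<in> verts G \<Longrightarrow> out_star v \<subseteq> verts G"
  by (auto simp: out_star_def)

lemma set_family_out_star: "set_family (verts G) (verts G - T)"
  by standard simp_all

text \<open>The successor along the linking, extended by the identity off the linking, maps
  \<open>inner L\<close> injectively into \<open>L - I\<close>.\<close>

lemma linkable_imp_free:
  assumes "I \<subseteq> verts G" "linkable G T I"
  shows "set_family.free (verts G) (verts G - T) out_star I"
proof -
  interpret set_family "verts G" "verts G - T" out_star by (rule set_family_out_star)
  obtain p where p: "\<And>v. v \<in> I \<Longrightarrow> \<exists>t \<in> T. apath v (p v) t"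
    and disj: "\<And>u v. u \<in> I \<Longrightarrow> v \<in> I \<Longrightarrow> u \<noteq> v \<Longrightarrow>
        set (awalk_verts u (p u)) \<inter> set (awalk_verts v (p v)) = {}"
    using assms(2) unfolding linkable_def by blast
  define P where "P = (\<Union>v\<in>I. set (awalk_verts v (p v)))"
  define B where "B = (\<Union>v\<in>I. set (p v))"
  have path: "set (p v) \<subseteq> arcs G" "v \<in> set (awalk_verts v (p v))"
    "inj_on (tail G) (set (p v))" "inj_on (head G) (set (p v))"
    "tail G ` set (p v) \<subseteq> set (awalk_verts v (p v))"
    "head G ` set (p v) \<subseteq> set (awalk_verts v (p v)) - {v}"
    "set (awalk_verts v (p v)) \<subseteq> T \<union> tail G ` set (p v)"
    if v: "v \<in> I" for v
  proof -
    obtain t where t: "t \<in> T" "awalk v (p v) t" "distinct (awalk_verts v (p v))"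
      using p[OF v] by (auto simp: apath_def)
    show "set (p v) \<subseteq> arcs G" using t(2) by blast
    show "v \<in> set (awalk_verts v (p v))" using t(2) by (rule hd_in_awalk_verts)
    have 1: "awalk_verts v (p v)
        = (if p v = [] then [v] else map (tail G) (p v) @ [head G (last (p v))])"
      by (rule awalk_verts_conv)
    have 2: "awalk_verts v (p v) = v # map (head G) (p v)"
      using t(2) awalk_verts_conv'[of v "p v" t] by (cases "p v") (auto simp: awalk_simps)
    show "inj_on (tail G) (set (p v))" "tail G ` set (p v) \<subseteq> set (awalk_verts v (p v))"
      using t(3) 1 by (auto simp: distinct_map split: if_splits)
    show "inj_on (head G) (set (p v))" "head G ` set (p v) \<subseteq> set (awalk_verts v (p v)) - {v}"
      using t(3) 2 by (auto simp: distinct_map)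
    have "last (awalk_verts v (p v)) = t" using t(2) by simp
    then show "set (awalk_verts v (p v)) \<subseteq> T \<union> tail G ` set (p v)"
      using 1 t(1) by (auto split: if_splits)
  qed
  \<comment> \<open>Arcs with the same value lie on the same path, as different paths share no
    vertex; so injectivity on each path suffices.\<close>
  have inj: "inj_on g B"
    if "\<And>v. v \<in> I \<Longrightarrow> inj_on g (set (p v))"
      and "\<And>v. v \<in> I \<Longrightarrow> g ` set (p v) \<subseteq> set (awalk_verts v (p v))" for g
  proof (rule inj_onI)
    fix a b assume ab: "a \<in> B" "b \<in> B" "g a = g b"
    then obtain u v where uv: "u \<in> I" "v \<in> I" "a \<in> set (p u)" "b \<in> set (p v)"
      by (auto simp: B_def)
    then have "u = v" using disj[of u v] that(2)[of u] that(2)[of v] ab(3) by force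
    then show "a = b" using that(1)[of u] uv ab(3) by (auto dest: inj_onD)
  qed
  have injt: "inj_on (tail G) B" using path by (intro inj) auto
  have injh: "inj_on (head G) B" using path by (intro inj) blast+
  \<comment> \<open>A head comes after the first vertex of its own path and misses all other paths,
    so it is never in \<open>I\<close>.\<close>
  have headB: "head G a \<in> P - I" if a: "a \<in> B" for a
  proof -
    obtain v where v: "v \<in> I" "a \<in> set (p v)" using a by (auto simp: B_def)
    then have h: "head G a \<in> set (awalk_verts v (p v))" "head G a \<noteq> v"
      using path(6)[OF v(1)] by auto
    have "head G a \<noteq> u" if "u \<in> I" for u
      using disj[OF v(1) that] path(2)[OF that] h by auto
    then show ?thesis using h v(1) by (auto simp: P_def)
  qed
  \<comment> \<open>Only the last vertex of a path can fail to be a tail, and it lies in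
    \<open>T\<close>.\<close>
  have PT: "w \<in> tail G ` B" if "w \<in> P" "w \<notin> T" for w
    using that path(7) by (force simp: P_def B_def)
  have IP: "I \<subseteq> P" using path(2) by (auto simp: P_def)
  have tailP: "tail G ` B \<subseteq> P" using path(5) by (force simp: P_def B_def)
  define f where "f w = (if w \<in> tail G ` B then head G (the_inv_into B (tail G) w) else w)" for w
  have f_tail: "f (tail G a) = head G a" if "a \<in> B" for a
    using that the_inv_into_f_f[OF injt that] by (simp add: f_def)
  have f_notin: "f w = w" "w \<notin> P" if "w \<notin> tail G ` B" "w \<in> verts G - T" for w
    using that PT by (auto simp: f_def)
  show ?thesis
    unfolding free_def
  proof (intro conjI allI impI)
    show "I \<subseteq> verts G" by fact
    fix L assume L: "I \<subseteq> L" "L \<subseteq> verts G"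
    have "f ` inner L \<subseteq> L - I"
    proof (rule image_subsetI)
      fix w assume w: "w \<in> inner L"
      then have wT: "w \<in> verts G - T" and out: "out_star w \<subseteq> L" by (auto simp: inner_def)
      show "f w \<in> L - I"
      proof (cases "w \<in> tail G ` B")
        case True
        then obtain a where a: "a \<in> B" "w = tail G a" by blast
        then have "a \<in> arcs G" using path(1) by (auto simp: B_def)
        then show ?thesis using headB[OF a(1)] f_tail[OF a(1)] a(2) out by (auto simp: out_star_def)
      next
        case False
        then show ?thesis using f_notin[OF False wT] out IP by (auto simp: out_star_def)
      qed
    qed
    moreover have "inj_on f (inner L)"
    proof (rule inj_onI)
      fix w w' assume w: "w \<in> inner L" "w' \<in> inner L" and eq: "f w = f w'"
      have wT: "w \<in> verts G - T" "w' \<in> verts G - T" using w by (auto simp: inner_def)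
      \<comment> \<open>In the mixed cases one value is a head, hence in \<open>P\<close>, and the
        other is a fixed vertex off \<open>P\<close>.\<close>
      consider a b where "a \<in> B" "b \<in> B" "w = tail G a" "w' = tail G b"
        | a where "a \<in> B" "w = tail G a" "w' \<notin> tail G ` B"
        | b where "b \<in> B" "w' = tail G b" "w \<notin> tail G ` B"
        | "w \<notin> tail G ` B" "w' \<notin> tail G ` B" by blast
      then show "w = w'"
      proof cases
        case 1
        then show ?thesis using eq f_tail inj_onD[OF injh] by metis
      next
        case 2
        then show ?thesis using eq f_tail[of a] headB[of a] f_notin[OF 2(3) wT(2)] by auto
      next
        case 3
        then show ?thesis using eq f_tail[of b] headB[of b] f_notin[OF 3(3) wT(1)] by auto
      next
        case 4
        then show ?thesis using eq f_notin wT by simp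
      qed
    qed
    ultimately have "card (inner L) \<le> card (L - I)"
      using L(2) by (intro card_inj_on_le[of f]) auto
    moreover have "card L = card (L - I) + card I"
      using L card_Un_Diff[of L I] assms(1) by (simp add: Un_absorb2)
    ultimately show "int (card I) \<le> slack L" by (simp add: slack_def)
  qed
qed

text \<open>The paths are the orbits, up to their first vertex in \<open>T\<close>, of the map sending each vertex to
  its representative. Since this map is injective and avoids \<open>I\<close>, orbits of points of \<open>I\<close> neither
  repeat vertices nor meet.\<close>

lemma free_imp_linkable:
  assumes "T \<subseteq> verts G" "set_family.free (verts G) (verts G - T) out_star I"
  shows "linkable G T I"
proof -
  interpret set_family "verts G" "verts G - T" out_star by (rule set_family_out_star)
  have IV: "I \<subseteq> verts G" using assms(2) by (simp add: free_def)
  let ?J = "verts G - T"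
  have "\<exists>s. inj_on s ?J \<and> (\<forall>v\<in>?J. s v \<in> out_star v - I)"
    by (rule free_imp_ex_sdr[OF assms(2)]) (simp add: out_star_subset)
  then obtain s where inj: "inj_on s ?J" and "\<forall>v\<in>?J. s v \<in> out_star v - I"
    by (elim exE conjE)
  then have s: "s v \<in> out_star v - I" if "v \<in> ?J" for v using that by (rule_tac bspec)
  \<comment> \<open>\<open>s\<close> is cancelled from both sides until one side is a point of
    \<open>I\<close>, which is not a value of \<open>s\<close> on \<open>?J\<close>; so both orbits
    are then at their start. This covers repetition within one path and meeting of two
    paths.\<close>
  have iter_eq: "i = j \<and> u = v"
    if "u \<in> I" "v \<in> I" "\<And>k. k < i \<Longrightarrow> (s ^^ k) u \<in> ?J" "\<And>k. k < j \<Longrightarrow> (s ^^ k) v \<in> ?J"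
      "(s ^^ i) u = (s ^^ j) v" for i j u v
    using that
  proof (induction i arbitrary: j)
    case 0
    then show ?case using s[of "(s ^^ (j - 1)) v"] by (cases j) auto
  next
    case (Suc i)
    have "(s ^^ i) u \<in> ?J" using Suc.prems(3) by simp
    then have si: "s ((s ^^ i) u) \<notin> I" using s by blast
    show ?case
    proof (cases j)
      case 0
      then show ?thesis using si Suc.prems by simp
    next
      case (Suc j')
      have "(s ^^ j') v \<in> ?J" using Suc.prems(4) Suc by simp
      then have "(s ^^ i) u = (s ^^ j') v"
        using inj_onD[OF inj] \<open>(s ^^ i) u \<in> ?J\<close> Suc.prems(5) Suc by simp
      then have "i = j' \<and> u = v"
        using Suc.prems Suc by (intro Suc.IH) auto
      then show ?thesis using Suc by simp
    qed
  qed
  \<comment> \<open>An orbit never reaching \<open>T\<close> would embed the naturals into a finite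
    set.\<close>
  have ex: "\<exists>n. (s ^^ n) v \<in> T" if v: "v \<in> I" for v
  proof (rule ccontr)
    assume "\<not> ?thesis"
    then have not_T: "(s ^^ n) v \<notin> T" for n by blast
    have J: "(s ^^ n) v \<in> ?J" for n
    proof (induction n)
      case 0
      then show ?case using v IV not_T[of 0] by auto
    next
      case (Suc n)
      then have "s ((s ^^ n) v) \<in> verts G" using s out_star_subset by blast
      then show ?case using not_T[of "Suc n"] by simp
    qed
    have "inj (\<lambda>n. (s ^^ n) v)"
    proof (rule injI)
      fix i j assume "(s ^^ i) v = (s ^^ j) v"
      then show "i = j" using iter_eq[of v v i j] v J by blast
    qed
    moreover have "range (\<lambda>n. (s ^^ n) v) \<subseteq> ?J" by (rule image_subsetI) (rule J)
    then have "finite (range (\<lambda>n. (s ^^ n) v))" by (rule finite_subset) simp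
    ultimately show False using finite_imageD infinite_UNIV_nat by blast
  qed
  define n where "n v = (LEAST n. (s ^^ n) v \<in> T)" for v
  have nT: "(s ^^ n v) v \<in> T" if "v \<in> I" for v
    unfolding n_def using ex[OF that] by (rule LeastI_ex)
  have J: "(s ^^ k) v \<in> ?J" if "v \<in> I" "k < n v" for v k
    using that(2)
  proof (induction k)
    case 0
    then show ?case using not_less_Least[of 0 "\<lambda>n. (s ^^ n) v \<in> T"] that(1) IV by (auto simp: n_def)
  next
    case (Suc k)
    then have "s ((s ^^ k) v) \<in> verts G" using s out_star_subset by force
    then show ?case
      using Suc.prems not_less_Least[of "Suc k" "\<lambda>n. (s ^^ n) v \<in> T"] by (auto simp: n_def)
  qed
  define a where "a v = (SOME e. e \<in> arcs G \<and> tail G e = v \<and> head G e = s v)" for v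
  have a: "a ((s ^^ k) v) \<in> arcs G \<and> tail G (a ((s ^^ k) v)) = (s ^^ k) v
      \<and> head G (a ((s ^^ k) v)) = (s ^^ Suc k) v" if v: "v \<in> I" "k < n v" for v k
  proof -
    \<comment> \<open>A representative may be the vertex itself, but orbits from \<open>I\<close> do
      not repeat, so here it is the head of an arc.\<close>
    have "(s ^^ Suc k) v \<noteq> (s ^^ k) v"
      using iter_eq[of v v "Suc k" k] J[OF v(1)] v by force
    then have "\<exists>e. e \<in> arcs G \<and> tail G e = (s ^^ k) v \<and> head G e = s ((s ^^ k) v)"
      using s[OF J[OF v]] by (auto simp: out_star_def)
    then show ?thesis unfolding a_def by (rule someI2_ex) simp
  qed
  define p where "p v = map (\<lambda>k. a ((s ^^ k) v)) [0..<n v]" for v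
  have verts: "awalk_verts v (p v) = map (\<lambda>k. (s ^^ k) v) [0..<Suc (n v)]" if v: "v \<in> I" for v
  proof (cases "n v")
    case 0
    then show ?thesis by (simp add: p_def)
  next
    case (Suc m)
    have "map (tail G) (p v) = map (\<lambda>k. (s ^^ k) v) [0..<n v]"
      using a[OF v] by (simp add: p_def)
    moreover have "head G (last (p v)) = (s ^^ n v) v"
      using a[OF v, of m] Suc by (simp add: p_def)
    ultimately show ?thesis using Suc by (simp add: awalk_verts_conv p_def)
  qed
  \<comment> \<open>Stated for all prefixes, so that the induction appends one arc at a
    time.\<close>
  have walk: "awalk v (map (\<lambda>k. a ((s ^^ k) v)) [0..<m]) ((s ^^ m) v)" if "v \<in> I" "m \<le> n v" for v m
    using that(2)
  proof (induction m)
    case 0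
    then show ?case using that(1) IV by (auto simp: awalk_Nil_iff)
  next
    case (Suc m)
    then show ?case using a[of v m] that(1)
      by (auto simp: awalk_simps) (metis head_in_verts)
  qed
  have apath: "apath v (p v) ((s ^^ n v) v)" if v: "v \<in> I" for v
  proof -
    have "inj_on (\<lambda>k. (s ^^ k) v) {0..<Suc (n v)}"
    proof (rule inj_onI)
      fix i j assume "i \<in> {0..<Suc (n v)}" "j \<in> {0..<Suc (n v)}" "(s ^^ i) v = (s ^^ j) v"
      then show "i = j" using iter_eq[of v v i j] J[OF v] v by auto
    qed
    then show ?thesis
      using walk[OF v, of "n v"] verts[OF v]
      by (simp add: apath_def p_def distinct_map del: upt_Suc)
  qed
  have "set (awalk_verts u (p u)) \<inter> set (awalk_verts v (p v)) = {}"
    if "u \<in> I" "v \<in> I" "u \<noteq> v" for u v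
  proof -
    have "(s ^^ i) u \<noteq> (s ^^ j) v" if "i < Suc (n u)" "j < Suc (n v)" for i j
      using iter_eq[of u v i j] J \<open>u \<in> I\<close> \<open>v \<in> I\<close> \<open>u \<noteq> v\<close> that by force
    then show ?thesis using that verts by (auto simp del: upt_Suc)
  qed
  then show ?thesis unfolding linkable_def using apath nT by blast
qed

lemma linkable_iff_free:
  "T \<subseteq> verts G \<Longrightarrow> I \<subseteq> verts G \<Longrightarrow>
    linkable G T I \<longleftrightarrow> set_family.free (verts G) (verts G - T) out_star I"
  using linkable_imp_free free_imp_linkable by blast

end

section \<open>The density of gammoids\<close>

text \<open>An independent set is its own only basis.\<close>

lemma indeps_contract_indep:
  assumes "F \<in> indeps M"
  shows "indeps (contract M F) = {I. I \<subseteq> ground M - F \<and> I \<union> F \<in> indeps M}"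
proof -
  have "basis_of M F B \<longleftrightarrow> B = F" for B
    using assms by (auto simp: basis_of_def)
  then show ?thesis by (simp add: contract_def)
qed

text \<open>\<open>F\<close> is contracted and everything outside \<open>Q\<close> deleted.
  Independence then depends only on size, so any bijection from \<open>Q\<close> onto
  \<open>{..<m}\<close> is an isomorphism.\<close>

lemma uniform_minor:
  assumes "F \<in> indeps M" "F \<subseteq> ground M" "Q \<subseteq> ground M - F" "finite Q" "card Q = m"
    and small: "\<And>X. X \<subseteq> Q \<Longrightarrow> X \<union> F \<in> indeps M \<longleftrightarrow> card X \<le> k"
  shows "\<exists>N. minor M N \<and> matroid_isomorphic N (uniform_matroid k m)"
proof -
  let ?C = "contract M F"
  let ?N = "delete ?C (ground M - F - Q)"
  have gC: "ground ?C = ground M - F" by (simp add: contract_def)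
  have gN: "ground ?N = Q" using assms(3) gC by (auto simp: delete_def)
  have iN: "X \<in> indeps ?N \<longleftrightarrow> card X \<le> k" if "X \<subseteq> Q" for X
  proof -
    have "X \<subseteq> ground M - F" "X \<subseteq> ground M - F - (ground M - F - Q)" using that assms(3) by auto
    then show ?thesis
      using small[OF that] by (simp add: delete_def gC indeps_contract_indep[OF assms(1)])
  qed
  have "minor M ?N" using assms(2) gC by (intro minor.intros) auto
  moreover have "matroid_isomorphic ?N (uniform_matroid k m)"
  proof -
    obtain g where g: "bij_betw g Q {..<m}"
      using ex_bij_betw_finite_nat[OF assms(4)] assms(5) by (auto simp: atLeast0LessThan)
    have "X \<in> indeps ?N \<longleftrightarrow> g ` X \<in> indeps (uniform_matroid k m)" if X: "X \<subseteq> Q" for X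
    proof -
      have "card (g ` X) = card X"
        using g X by (intro card_image) (auto simp: bij_betw_def intro: inj_on_subset)
      moreover have "g ` X \<subseteq> {..<m}" using g X by (auto simp: bij_betw_def)
      ultimately show ?thesis using iN[OF X] by (simp add: uniform_matroid_def)
    qed
    then show ?thesis
      unfolding matroid_isomorphic_def gN using g
      by (intro exI[of _ g]) (simp add: uniform_matroid_def)
  qed
  ultimately show ?thesis by blast
qed

text \<open>This replaces the digraph by its family of out-stars. The map \<open>f\<close> appears
  because \<open>M\<close> is only isomorphic to a gammoid on naturals.\<close>

lemma gammoid_free_representation:
  assumes "gammoid M"
  obtains V J :: "nat set" and A f where "set_family V J" "inj_on f (ground M)"
    "f ` ground M \<subseteq> V"
    "\<And>X. X \<subseteq> ground M \<Longrightarrow> X \<in> indeps M \<longleftrightarrow> set_family.free V J A (f ` X)"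
proof -
  obtain D :: "(nat, nat) pre_digraph" and T E where D: "fin_digraph D" "T \<subseteq> verts D" "E \<subseteq> verts D"
    and "matroid_isomorphic M (gammoid_of D T E)"
    using assms by (auto simp: gammoid_def)
  then obtain f where f: "bij_betw f (ground M) E"
    and iff: "\<And>X. X \<subseteq> ground M \<Longrightarrow> X \<in> indeps M \<longleftrightarrow> f ` X \<in> indeps (gammoid_of D T E)"
    by (auto simp: matroid_isomorphic_def gammoid_of_def)
  interpret fin_digraph D by (rule D)
  show thesis
  proof
    show "set_family (verts D) (verts D - T)" by (rule set_family_out_star)
    show "inj_on f (ground M)" "f ` ground M \<subseteq> verts D"
      using f D(3) by (auto simp: bij_betw_def)
    fix X assume X: "X \<subseteq> ground M"
    then have "f ` X \<subseteq> E" using f by (auto simp: bij_betw_def)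
    then show "X \<in> indeps M \<longleftrightarrow> set_family.free (verts D) (verts D - T) out_star (f ` X)"
      using iff[OF X] linkable_iff_free[OF D(2), of "f ` X"] D(3) by (auto simp: gammoid_of_def)
  qed
qed

theorem theorem1p1:
  fixes M :: "'a set_system" and l r :: nat
  assumes "l \<ge> 1" and "r \<ge> 1"
    and "gammoid M"
    and "simple_matroid M"
    and "matroid_rank M = r"
    and "\<not> (\<exists>N. minor M N \<and> matroid_isomorphic N (uniform_matroid 2 (l + 2)))"
  shows "card (ground M) \<le> l * (r - 1) + 1"
proof (rule ccontr)
  assume "\<not> ?thesis"
  then have dense: "l * (r - 1) + 2 \<le> card (ground M)" by simp
  have "matroid M" using assms(4) by (simp add: simple_matroid_def)
  then interpret matroid M .
  obtain V J :: "nat set" and A f where fam: "set_family V J" and inj: "inj_on f (ground M)"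
    and fV: "f ` ground M \<subseteq> V"
    and iff: "\<And>X. X \<subseteq> ground M \<Longrightarrow> X \<in> indeps M \<longleftrightarrow> set_family.free V J A (f ` X)"
    by (rule gammoid_free_representation[OF assms(3)]) (rule that)
  have pair: "{x, y} \<in> indeps M" if "x \<in> ground M" "y \<in> ground M" for x y
    using assms(4) that unfolding simple_matroid_def is_loop_def parallel_pair_def
    by (cases "x = y") auto
  have "indeps M \<subseteq> Pow (ground M)" using indep_subset_ground by blast
  then have "finite (indeps M)" by (rule finite_subset) (simp add: finite_ground)
  then have rank: "card I \<le> r" if "I \<in> indeps M" for I
    using that assms(5) by (auto simp: matroid_rank_def)
  have "\<exists>F Q. F \<subseteq> f ` ground M \<and> Q \<subseteq> f ` ground M - F \<and> card Q = l + 2 \<and>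
    (\<forall>x\<in>Q. \<forall>y\<in>Q. set_family.free V J A (F \<union> {x, y})) \<and>
    (\<forall>X\<subseteq>Q. card X = 3 \<longrightarrow> \<not> set_family.free V J A (F \<union> X))"
  proof (rule ex_dense_line[OF fam fV assms(1)])
    show "set_family.free V J A {x, y}"
      if xy: "x \<in> f ` ground M" "y \<in> f ` ground M" for x y
    proof -
      obtain x' y' where "x' \<in> ground M" "y' \<in> ground M" "x = f x'" "y = f y'"
        using xy by blast
      then show ?thesis using iff[of "{x', y'}"] pair[of x' y'] by simp
    qed
    show "card I \<le> r" if I: "I \<subseteq> f ` ground M" "set_family.free V J A I" for I
    proof -
      obtain I' where I': "I' \<subseteq> ground M" "I = f ` I'" using I(1) by (rule subset_imageE)
      moreover have "card I = card I'"
        unfolding I'(2) using inj I'(1) by (intro card_image) (rule inj_on_subset)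
      ultimately show ?thesis using rank[of I'] iff[OF I'(1)] I(2) by simp
    qed
    show "l * (r - 1) + 2 \<le> card (f ` ground M)" using dense inj by (simp add: card_image)
  qed
  then obtain F' Q' where F': "F' \<subseteq> f ` ground M" and Q': "Q' \<subseteq> f ` ground M - F'" "card Q' = l + 2"
    and two': "\<forall>x\<in>Q'. \<forall>y\<in>Q'. set_family.free V J A (F' \<union> {x, y})"
    and three': "\<forall>X\<subseteq>Q'. card X = 3 \<longrightarrow> \<not> set_family.free V J A (F' \<union> X)"
    by (elim exE conjE)
  \<comment> \<open>The configuration is pulled back along \<open>f\<close>, which is injective on
    the ground set.\<close>
  define F where "F = {x \<in> ground M. f x \<in> F'}"
  define Q where "Q = {x \<in> ground M. f x \<in> Q'}"
  have fF: "f ` F = F'" "F \<subseteq> ground M" using F' by (auto simp: F_def)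
  have fQ: "f ` Q = Q'" "Q \<subseteq> ground M - F" using Q'(1) by (auto simp: F_def Q_def)
  have cardf: "card (f ` X) = card X" if "X \<subseteq> ground M" for X
    using inj that by (intro card_image) (rule inj_on_subset)
  have two: "F \<union> {x, y} \<in> indeps M" if "x \<in> Q" "y \<in> Q" for x y
  proof -
    have "F \<union> {x, y} \<subseteq> ground M" using fF fQ that by blast
    moreover have "f ` (F \<union> {x, y}) = F' \<union> {f x, f y}" using fF by (simp add: image_Un)
    moreover have "f x \<in> Q'" "f y \<in> Q'" using that by (auto simp: Q_def)
    ultimately show ?thesis using iff[of "F \<union> {x, y}"] two' by metis
  qed
  have three: "F \<union> X \<notin> indeps M" if "X \<subseteq> Q" "card X = 3" for X
  proof -
    have "F \<union> X \<subseteq> ground M" "X \<subseteq> ground M" using fF fQ that by auto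
    moreover have "f ` (F \<union> X) = F' \<union> f ` X" using fF by (simp add: image_Un)
    moreover have "f ` X \<subseteq> Q'" using that fQ by auto
    ultimately show ?thesis using iff[of "F \<union> X"] three' cardf[of X] that(2) by metis
  qed
  have "Q \<subseteq> ground M" using fQ(2) by blast
  then have finQ: "finite Q" and cardQ: "card Q = l + 2"
    using fQ(1) finite_ground finite_subset[of Q "ground M"] cardf[of Q] Q'(2) by auto
  then have "Q \<noteq> {}" by auto
  then obtain q where "q \<in> Q" by blast
  have "X \<union> F \<in> indeps M \<longleftrightarrow> card X \<le> 2" if X: "X \<subseteq> Q" for X
  proof
    assume XF: "X \<union> F \<in> indeps M"
    show "card X \<le> 2"
    proof (rule ccontr)
      assume "\<not> card X \<le> 2"
      then obtain Y where Y: "Y \<subseteq> X" "card Y = 3"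
        using obtain_subset_with_card_n[of 3 X] by auto
      then have "F \<union> Y \<in> indeps M" using indep_mono[OF XF, of "F \<union> Y"] by blast
      then show False using three[of Y] Y X by blast
    qed
  next
    assume "card X \<le> 2"
    have "finite X" using X finQ finite_subset by blast
    \<comment> \<open>\<open>x\<close> and \<open>y\<close> may coincide; for empty \<open>X\<close>
      the element \<open>q\<close> serves as both.\<close>
    obtain x y where "x \<in> Q" "y \<in> Q" "X \<subseteq> {x, y}"
    proof -
      consider "card X = 0" | "card X = 1" | "card X = 2" using \<open>card X \<le> 2\<close> by linarith
      then show thesis
      proof cases
        case 1
        then show thesis using that[of q q] \<open>q \<in> Q\<close> \<open>finite X\<close> by simp
      next
        case 2
        then obtain x where "X = {x}" by (auto simp: card_1_singleton_iff)
        then show thesis using that[of x x] X by simp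
      next
        case 3
        then obtain x y where "X = {x, y}" by (auto simp: card_2_iff)
        then show thesis using that[of x y] X by simp
      qed
    qed
    then show "X \<union> F \<in> indeps M" using indep_mono[OF two[of x y], of "X \<union> F"] by blast
  qed
  moreover have "F \<in> indeps M" using indep_mono[OF two[OF \<open>q \<in> Q\<close> \<open>q \<in> Q\<close>], of F] by blast
  ultimately show False
    using assms(6) uniform_minor[OF _ fF(2) fQ(2) finQ cardQ, of 2] by blast
qed

end
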